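(* Let $m\ge n$, let $f:\mathbf{R}^n\to\mathbf{R}\cup\{\infty\}$ be an absolutely symmetric convex function, not identically $\infty$, and let $F:\mathbf{R}^{m\times n}\to\mathbf{R}\cup\{\infty\}$ be the corresponding unitarily invariant function, $F(X)=f(\boldsymbol{\sigma}(X))$. Let $K_F\subseteq\mathbf{R}\times\mathbf{R}\times\mathbf{R}^{m\times n}$ and $K_f\subseteq\mathbf{R}\times\mathbf{R}\times\mathbf{R}^n$ be the associated spectral matrix cone and spectral vector cone. Let $(\bar t,\bar v,\bar X)\in\mathbf{R}\times\mathbf{R}\times\mathbf{R}^{m\times n}$, where $\bar X$ has reduced singular value decomposition $\bar X=U\,\mathrm{diag}(\bar\sigma)\,V^T$ with $U\in\mathbf{R}^{m\times n}$ and $V\in\mathbf{R}^{n\times n}$ (so $U^TU=V^TV=I$) and singular values $\bar\sigma\in\mathbf{R}^n$. Then $$ \begin{aligned} \Pi_{K_F}(\bar t,\bar v,\bar X)_1 &= \Pi_{K_f}(\bar t,\bar v,\bar\sigma)_1,\\ \Pi_{K_F}(\bar t,\bar v,\bar X)_2 &= \Pi_{K_f}(\bar t,\bar v,\bar\sigma)_2,\\ \Pi_{K_F}(\bar t,\bar v,\bar X)_3 &= U\,\mathrm{diag}\big(\Pi_{K_f}(\bar t,\bar v,\bar\sigma)_3\big)\,V^T, \end{aligned} $$ where the subscripts $1,2,3$ denote the first, second and last components of the projections, which lie in $\mathbf{R}$, $\mathbf{R}$, $\mathbf{R}^{m\times n}$ for $\Pi_{K_F}$ and in $\mathbf{R}$,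 $\mathbf{R}$, $\mathbf{R}^n$ for $\Pi_{K_f}$.
   Context: $\mathbf{R}_{++}=(0,\infty)$. For $X\in\mathbf{R}^{m\times n}$ with $m\ge n$, $\boldsymbol{\sigma}(X)=(\sigma_1(X),\dots,\sigma_n(X))\in\mathbf{R}^n$ is the vector of (nonnegative) singular values of $X$ in nonincreasing order. For $x\in\mathbf{R}^n$, $\mathrm{diag}(x)$ is the $n\times n$ diagonal matrix with diagonal $x$. A function $f:\mathbf{R}^n\to\mathbf{R}\cup\{\infty\}$ is absolutely symmetric if $f(x)=f(|Px|)$ for all $x$ and all permutation matrices $P\in\mathbf{R}^{n\times n}$, where $|\cdot|$ is the elementwise absolute value. A function $F:\mathbf{R}^{m\times n}\to\mathbf{R}\cup\{\infty\}$ is unitarily invariant if $F(X)=F(UXV)$ for all $X$ and all (real) unitary, i.e. orthogonal, matrices $U\in\mathbf{R}^{m\times m}$ and $V\in\mathbf{R}^{n\times n}$. The (convex) unitarily invariant function corresponding to an absolutely symmetric convex $f$ is $F(X)=f(\boldsymbol{\sigma}(X))$. The spectral matrix cone of $F$ and the spectral vector cone of $f$ are the closed convex cones $$K_F=\mathrm{cl}\{(t,v,X)\in\mathbf{R}\times\mathbf{R}_{++}\times\mathbf{R}^{m\times n} \mid vF(X/v)\le t\},$$ $$K_f=\mathrm{cl}\{(t,v,x)\in\mathbf{R}\times\mathbf{R}_{++}\times\mathbf{R}^n \mid vf(x/v)\le t\},$$ where $\mathrm{cl}$ denotes closure (in $\mathbf{R}\times\mathbf{R}\times\mathbf{R}^{m\times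 n}$ and $\mathbf{R}\times\mathbf{R}\times\mathbf{R}^n$, respectively). $\Pi_{K_F}(\bar t,\bar v,\bar X)$ is the Euclidean projection onto $K_F$, i.e. the unique minimizer of $\tfrac12(t-\bar t)^2+\tfrac12(v-\bar v)^2+\tfrac12\|X-\bar X\|_F^2$ over $(t,v,X)\in K_F$, with $\|\cdot\|_F$ the Frobenius norm. $\Pi_{K_f}(\bar t,\bar v,\bar\sigma)$ is the Euclidean projection onto $K_f$, i.e. the unique minimizer of $\tfrac12(t-\bar t)^2+\tfrac12(v-\bar v)^2+\tfrac12\|x-\bar\sigma\|_2^2$ over $(t,v,x)\in K_f$. *)

theory Defs
  imports "HOL-Analysis.Analysis"
begin

definition diag_matrix :: "real^'n \<Rightarrow> real^'n^'n" where
  "diag_matrix x = (\<chi> i j. if i = j then x $ i else 0)"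

text \<open>
  The entries of \<open>s\<close> are nonnegative but in no particular order here; the ordering convention
  is imposed only in \<open>singular_values\<close>.
\<close>

definition reduced_svd :: "real^'n^'m \<Rightarrow> real^'n^'m \<Rightarrow> real^'n \<Rightarrow> real^'n^'n \<Rightarrow> bool" where
  "reduced_svd X U s V \<longleftrightarrow>
     transpose U ** U = mat 1 \<and> transpose V ** V = mat 1 \<and> (\<forall>i. 0 \<le> s $ i) \<and>
     X = U ** diag_matrix s ** transpose V"

text \<open>
  Coordinates are indexed by a linearly ordered finite type, so that ``nonincreasing'' makes
  sense. The description determines the vector whenever \<open>X\<close> has at least as many
  rows as columns, and is meaningless otherwise.
\<close>

definition singular_values :: "real^'n::{finite,linorder}^'m \<Rightarrow> real^'n::{finite,linorder}" where
  "singular_values X = (THE s. antimono (($) s) \<and> (\<exists>U V. reduced_svd X U s V))"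

definition permutation_matrix :: "real^'n^'n \<Rightarrow> bool" where
  "permutation_matrix P \<longleftrightarrow> (\<exists>\<pi>. bij \<pi> \<and> P = (\<chi> i j. if j = \<pi> i then 1 else 0))"

text \<open>The absolute value on vectors is the componentwise one of the library.\<close>

definition absolutely_symmetric :: "(real^'n \<Rightarrow> ereal) \<Rightarrow> bool" where
  "absolutely_symmetric f \<longleftrightarrow> (\<forall>x P. permutation_matrix P \<longrightarrow> f x = f \<bar>P *v x\<bar>)"

text \<open>
  The library's \<open>convex_on\<close> is for real-valued functions only. The inequality below is the usual
  one provided that \<open>f\<close> never takes the value \<open>-\<infinity>\<close>.
\<close>

definition convex_ereal :: "('a::real_vector \<Rightarrow> ereal) \<Rightarrow> bool" where
  "convex_ereal f \<longleftrightarrow>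
     (\<forall>x y u v. 0 < u \<longrightarrow> 0 < v \<longrightarrow> u + v = 1 \<longrightarrow>
        f (u *\<^sub>R x + v *\<^sub>R y) \<le> ereal u * f x + ereal v * f y)"

text \<open>
  Used both for functions of vectors and for functions of matrices. The norm on
  \<^typ>\<open>real^'n^'m\<close> is the Frobenius norm, and products carry the Euclidean product norm, so
  \<^const>\<open>closest_point\<close> is the projection of the intended least-squares problem in both cases.
\<close>

definition spectral_cone :: "('a::real_normed_vector \<Rightarrow> ereal) \<Rightarrow> (real \<times> real \<times> 'a) set" where
  "spectral_cone g = closure {(t, v, x). 0 < v \<and> ereal v * g (x /\<^sub>R v) \<le> ereal t}"

end

theory Submission
  imports Defs
begin

text \<open>
  Write \<open>D d\<close> for \<open>U diag(d) V\<^sup>T\<close>, so that \<open>D\<close> is a linear isometry with \<open>X = D s\<close>, and let \<open>(a, b, y)\<close> be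
  the projection of \<open>(t, v, s)\<close> onto the vector cone. The claim is that \<open>(a, b, D y)\<close> is the
  projection of \<open>(t, v, D s)\<close> onto the matrix cone. It lies in that cone, because the
  singular values of \<open>D x\<close> are those of a signed permutation of \<open>x\<close>, whence \<open>F (D x) = f x\<close>.
  Optimality and uniqueness both follow from the variational inequality: the residual
  \<open>(t - a, v - b, D (s - y))\<close> has to make an obtuse angle with \<open>w - (a, b, D y)\<close> for every \<open>w\<close> in
  the matrix cone (\<open>closest_point_eqI\<close>), and closedness allows \<open>w\<close> to be restricted to the
  triples \<open>(t', v', Y)\<close> whose closure is the cone.

  There the problem reduces to vectors. By von Neumann's trace inequality, applied
  after sorting, there is a signed permutation \<open>x\<close> of the singular values of \<open>Y\<close> with
  \<open>\<langle>D d, Y\<rangle> \<le> \<langle>d, x\<rangle>\<close>; take \<open>d = s - y\<close> (\<open>inner_diag_le_signed_permutation\<close>). By absolute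
  symmetry of \<open>f\<close>, the triple \<open>(t', v', x)\<close> lies in the vector cone, and the variational
  inequality of the projection onto that convex cone concludes.

  Two facts of matrix analysis support this. The trace inequality
  (\<open>von_neumann_trace_inequality\<close>) holds because the products of cosines between the two
  systems of singular vectors form a substochastic matrix, so that the rearrangement
  inequality applies; it also gives uniqueness of the ordered singular values. Existence of a singular value decomposition
  (\<open>exists_singular_system\<close>) comes from maximising \<open>\<langle>a, X b\<rangle>\<close> over unit vectors orthogonal to
  the singular vectors already found.
\<close>

section \<open>Rearrangement with substochastic weights\<close>

text \<open>
  Summation by parts, arranged as an induction that removes the largest index \<open>b\<close>: splitting
  off the constant \<open>s b\<close> leaves nonnegative nonincreasing weights on the remaining indices
  and a nonnegative multiple of the full sum.
\<close>

lemma abel_sum_nonneg: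
  fixes s e :: "'a::linorder \<Rightarrow> real"
  assumes "finite A"
    and "\<And>i j. i \<in> A \<Longrightarrow> j \<in> A \<Longrightarrow> i \<le> j \<Longrightarrow> s j \<le> s i"
    and "\<And>i. i \<in> A \<Longrightarrow> 0 \<le> s i"
    and "\<And>k. k \<in> A \<Longrightarrow> 0 \<le> (\<Sum>i | i \<in> A \<and> i \<le> k. e i)"
  shows "0 \<le> (\<Sum>i\<in>A. s i * e i)"
  using assms
proof (induction A arbitrary: s rule: finite_linorder_max_induct)
  case empty
  then show ?case by simp
next
  case (insert b A)
  have b: "b \<notin> A" using insert.hyps by auto
  have "(\<Sum>i | i \<in> insert b A \<and> i \<le> k. e i) = (\<Sum>i | i \<in> A \<and> i \<le> k. e i)" if "k \<in> A" for k
    using insert.hyps that by (intro sum.cong) auto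
  then have part: "0 \<le> (\<Sum>i | i \<in> A \<and> i \<le> k. e i)" if "k \<in> A" for k
    using insert.prems(3)[of k] that by auto
  have "{i. i \<in> insert b A \<and> i \<le> b} = insert b A" using insert.hyps by auto
  then have total: "0 \<le> (\<Sum>i\<in>insert b A. e i)"
    using insert.prems(3)[of b] by simp
  have mono: "s b \<le> s i" if "i \<in> A" for i
    using insert.prems(1)[of i b] insert.hyps that by auto
  have "0 \<le> (\<Sum>i\<in>A. (s i - s b) * e i)"
    using insert.prems(1) mono part by (intro insert.IH) auto
  moreover have "0 \<le> s b * (\<Sum>i\<in>insert b A. e i)"
    using insert.prems(2)[of b] total by simp
  moreover have "(\<Sum>i\<in>insert b A. s i * e i) =
      (\<Sum>i\<in>A. (s i - s b) * e i) + s b * (\<Sum>i\<in>insert b A. e i)"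
    using insert.hyps b
    by (simp add: sum_distrib_left left_diff_distrib sum_subtractf distrib_left)
  ultimately show ?case by linarith
qed

lemma abel_sum_mono:
  fixes s g h :: "'n::{finite,linorder} \<Rightarrow> real"
  assumes "antimono s" "\<And>i. 0 \<le> s i"
    and "\<And>k. (\<Sum>i | i \<le> k. g i) \<le> (\<Sum>i | i \<le> k. h i)"
  shows "(\<Sum>i\<in>UNIV. s i * g i) \<le> (\<Sum>i\<in>UNIV. s i * h i)"
  using abel_sum_nonneg[of UNIV s "\<lambda>i. h i - g i"] assms
  by (simp add: antimono_def sum_subtractf right_diff_distrib)

text \<open>
  Nonincreasing nonnegative vectors are nonnegative combinations of indicators of initial
  segments, so it suffices to bound the sum of \<open>B\<close> over a \<open>k\<close> by \<open>l\<close> corner block: it is at most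
  the length of the shorter side. Summation by parts in each of the two indices carries out
  this reduction.
\<close>

lemma substochastic_rearrangement:
  fixes s r :: "'n::{finite,linorder} \<Rightarrow> real"
  assumes "antimono s" "\<And>i. 0 \<le> s i" "antimono r" "\<And>i. 0 \<le> r i"
    and rows: "\<And>i. (\<Sum>j\<in>UNIV. \<bar>B i j\<bar>) \<le> 1"
    and cols: "\<And>j. (\<Sum>i\<in>UNIV. \<bar>B i j\<bar>) \<le> 1"
  shows "(\<Sum>i\<in>UNIV. \<Sum>j\<in>UNIV. s i * r j * B i j) \<le> (\<Sum>i\<in>UNIV. s i * r i)"
proof -
  have block: "(\<Sum>j | j \<le> l. \<Sum>i | i \<le> k. B i j) \<le> (\<Sum>j | j \<le> l. if j \<le> k then 1 else 0)"
    for k l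
  proof (cases "k \<le> l")
    case True
    have "(\<Sum>j | j \<le> l. \<Sum>i | i \<le> k. B i j) = (\<Sum>i | i \<le> k. \<Sum>j | j \<le> l. B i j)"
      by (rule sum.swap)
    also have "\<dots> \<le> (\<Sum>i | i \<le> k. \<Sum>j\<in>UNIV. \<bar>B i j\<bar>)"
      by (intro sum_mono order_trans[OF sum_mono sum_mono2]) (auto intro: abs_ge_self)
    also have "\<dots> \<le> (\<Sum>i | i \<le> k. 1)" by (intro sum_mono rows)
    also have "\<dots> = (\<Sum>j | j \<le> l. if j \<le> k then 1 else 0)"
      using True by (intro sum.mono_neutral_cong_left) auto
    finally show ?thesis .
  next
    case False
    have "(\<Sum>j | j \<le> l. \<Sum>i | i \<le> k. B i j) \<le> (\<Sum>j | j \<le> l. \<Sum>i\<in>UNIV. \<bar>B i j\<bar>)"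
      by (intro sum_mono order_trans[OF sum_mono sum_mono2]) (auto intro: abs_ge_self)
    also have "\<dots> \<le> (\<Sum>j | j \<le> l. 1)" by (intro sum_mono cols)
    also have "\<dots> = (\<Sum>j | j \<le> l. if j \<le> k then 1 else 0)"
      using False by (intro sum.cong) auto
    finally show ?thesis .
  qed
  have "(\<Sum>i | i \<le> k. \<Sum>j\<in>UNIV. r j * B i j) \<le> (\<Sum>i | i \<le> k. r i)" for k
  proof -
    have "(\<Sum>i | i \<le> k. \<Sum>j\<in>UNIV. r j * B i j) = (\<Sum>j\<in>UNIV. r j * (\<Sum>i | i \<le> k. B i j))"
      by (subst sum.swap) (simp add: sum_distrib_left)
    also have "\<dots> \<le> (\<Sum>j\<in>UNIV. r j * (if j \<le> k then 1 else 0))"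
      using assms block by (intro abel_sum_mono) auto
    also have "\<dots> = (\<Sum>i | i \<le> k. r i)"
      by (intro sum.mono_neutral_cong_right) auto
    finally show ?thesis .
  qed
  then have "(\<Sum>i\<in>UNIV. s i * (\<Sum>j\<in>UNIV. r j * B i j)) \<le> (\<Sum>i\<in>UNIV. s i * r i)"
    using assms by (intro abel_sum_mono) auto
  then show ?thesis by (simp add: sum_distrib_left mult.assoc)
qed

section \<open>The trace inequality and uniqueness of singular values\<close>

definition orthonormal_on :: "'i set \<Rightarrow> ('i \<Rightarrow> 'a::real_inner) \<Rightarrow> bool" where
  "orthonormal_on I u \<longleftrightarrow> (\<forall>i\<in>I. \<forall>j\<in>I. u i \<bullet> u j = (if i = j then 1 else 0))"

lemma eq_if_inner_diff_le_zero:
  fixes x y :: "'a::real_inner"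
  assumes "(x - y) \<bullet> (x - y) \<le> 0"
  shows "x = y"
proof -
  have "(norm (x - y))\<^sup>2 \<le> 0" using assms by (simp only: power2_norm_eq_inner)
  then show ?thesis by simp
qed

lemma inner_sum_orthonormal:
  assumes "orthonormal_on I u" "finite I"
  shows "(\<Sum>i\<in>I. a i *\<^sub>R u i) \<bullet> (\<Sum>i\<in>I. b i *\<^sub>R u i) = (\<Sum>i\<in>I. a i * b i)"
proof -
  have "(\<Sum>i\<in>I. a i *\<^sub>R u i) \<bullet> (\<Sum>i\<in>I. b i *\<^sub>R u i) =
      (\<Sum>i\<in>I. \<Sum>j\<in>I. if j = i then a i * b i else 0)"
    using assms unfolding inner_sum_left inner_sum_right
    by (intro sum.cong) (auto simp: orthonormal_on_def)
  then show ?thesis using assms(2) by simp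
qed

lemma bessel_inequality:
  assumes "orthonormal_on I u" "finite I"
  shows "(\<Sum>i\<in>I. (x \<bullet> u i)\<^sup>2) \<le> x \<bullet> x"
proof -
  let ?p = "\<Sum>i\<in>I. (x \<bullet> u i) *\<^sub>R u i"
  have "0 \<le> (x - ?p) \<bullet> (x - ?p)" by simp
  also have "\<dots> = x \<bullet> x - 2 * (x \<bullet> ?p) + ?p \<bullet> ?p"
    by (simp add: inner_diff_left inner_diff_right inner_commute)
  also have "x \<bullet> ?p = (\<Sum>i\<in>I. (x \<bullet> u i)\<^sup>2)"
    by (simp add: inner_sum_right power2_eq_square)
  also have "?p \<bullet> ?p = (\<Sum>i\<in>I. (x \<bullet> u i)\<^sup>2)"
    using inner_sum_orthonormal[OF assms] by (simp add: power2_eq_square)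
  finally show ?thesis by simp
qed

definition outer_product :: "real^'m \<Rightarrow> real^'n \<Rightarrow> real^'n^'m" where
  "outer_product u v = (\<chi> i j. u $ i * v $ j)"

lemma inner_outer_product:
  "outer_product u v \<bullet> outer_product u' v' = (u \<bullet> u') * (v \<bullet> v')"
  unfolding outer_product_def inner_vec_def sum_product
  by (simp add: mult_ac)

lemma orthonormal_outer_products:
  assumes "orthonormal_on I u" "orthonormal_on I v"
  shows "orthonormal_on I (\<lambda>k. outer_product (u k) (v k))"
  using assms by (auto simp: orthonormal_on_def inner_outer_product)

lemma outer_product_scaleR:
  "outer_product (a *\<^sub>R u) v = a *\<^sub>R outer_product u v"
  by (simp add: outer_product_def vec_eq_iff)

lemma diag_product_eq_sum_outer:
  fixes U :: "real^'n^'m" and V :: "real^'n^'n"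
  shows "U ** diag_matrix d ** transpose V =
    (\<Sum>k\<in>UNIV. d $ k *\<^sub>R outer_product (column k U) (column k V))"
proof -
  have "(U ** diag_matrix d) $ i $ k = U $ i $ k * d $ k" for i k
    by (simp add: matrix_matrix_mult_def diag_matrix_def if_distrib cong: if_cong)
  then show ?thesis
    by (simp add: vec_eq_iff outer_product_def matrix_matrix_mult_def[of "U ** _"]
        transpose_def column_def mult_ac)
qed

lemma orthonormal_columns_iff:
  fixes U :: "real^'n^'m"
  shows "transpose U ** U = mat 1 \<longleftrightarrow> orthonormal_on UNIV (\<lambda>k. column k U)"
proof -
  have "(transpose U ** U) $ i $ j = column i U \<bullet> column j U" for i j
    by (simp add: matrix_matrix_mult_def transpose_def column_def inner_vec_def)
  then show ?thesis by (simp add: mat_def vec_eq_iff orthonormal_on_def)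
qed

lemma reduced_svd_iff:
  "reduced_svd X U s V \<longleftrightarrow>
     orthonormal_on UNIV (\<lambda>k. column k U) \<and> orthonormal_on UNIV (\<lambda>k. column k V) \<and>
     (\<forall>i. 0 \<le> s $ i) \<and> X = (\<Sum>k\<in>UNIV. s $ k *\<^sub>R outer_product (column k U) (column k V))"
  by (simp add: reduced_svd_def orthonormal_columns_iff diag_product_eq_sum_outer)

text \<open>
  The coefficients that the trace inequality feeds into the rearrangement inequality:
  \<open>\<bar>xy\<bar> \<le> (x\<^sup>2 + y\<^sup>2) / 2\<close> reduces the bound on a row of products to Bessel's inequality for each of
  the two families.
\<close>

lemma orthonormal_products_bound:
  assumes "orthonormal_on UNIV (u :: 'i::finite \<Rightarrow> 'a::real_inner)" "a \<bullet> a = 1"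
    and "orthonormal_on UNIV (v :: 'i \<Rightarrow> 'b::real_inner)" "b \<bullet> b = 1"
  shows "(\<Sum>j\<in>UNIV. \<bar>(a \<bullet> u j) * (b \<bullet> v j)\<bar>) \<le> 1"
proof -
  have "\<bar>x * y\<bar> \<le> (x\<^sup>2 + y\<^sup>2) / 2" for x y :: real
    using sum_squares_bound[of "\<bar>x\<bar>" "\<bar>y\<bar>"] by (simp add: abs_mult)
  then have "(\<Sum>j\<in>UNIV. \<bar>(a \<bullet> u j) * (b \<bullet> v j)\<bar>) \<le>
      (\<Sum>j\<in>UNIV. ((a \<bullet> u j)\<^sup>2 + (b \<bullet> v j)\<^sup>2) / 2)"
    by (intro sum_mono) blast
  also have "\<dots> = ((\<Sum>j\<in>UNIV. (a \<bullet> u j)\<^sup>2) + (\<Sum>j\<in>UNIV. (b \<bullet> v j)\<^sup>2)) / 2"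
    by (simp add: sum.distrib flip: sum_divide_distrib)
  also have "\<dots> \<le> 1"
    using bessel_inequality[OF assms(1), of a] bessel_inequality[OF assms(3), of b] assms by simp
  finally show ?thesis .
qed

lemma inner_sum_outer_products:
  "(\<Sum>k\<in>UNIV. d k *\<^sub>R outer_product (u k) (v k)) \<bullet> (\<Sum>k\<in>UNIV. e k *\<^sub>R outer_product (u' k) (v' k))
     = (\<Sum>i\<in>UNIV. \<Sum>j\<in>UNIV. d i * e j * ((u i \<bullet> u' j) * (v i \<bullet> v' j)))"
  unfolding inner_sum_left
  unfolding inner_sum_right
  by (simp add: inner_outer_product mult_ac)

text \<open>
  Expanding both matrices in rank-one terms gives \<open>\<Sum>i j. s i * s' j * B i j\<close>, where \<open>B i j\<close> is the
  product of the cosines between the \<open>i\<close>-th pair of singular vectors of \<open>X\<close> and the \<open>j\<close>-th of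
  \<open>Y\<close>. The rows and columns of \<open>\<bar>B\<bar>\<close> have sums at most 1.
\<close>

lemma von_neumann_trace_inequality:
  fixes X Y :: "real^'n::{finite,linorder}^'m"
  assumes X: "reduced_svd X U s V" and Y: "reduced_svd Y U' s' V'"
    and "antimono (($) s)" "antimono (($) s')"
  shows "X \<bullet> Y \<le> s \<bullet> s'"
proof -
  define B where "B i j = (column i U \<bullet> column j U') * (column i V \<bullet> column j V')" for i j
  note X = X[unfolded reduced_svd_iff] and Y = Y[unfolded reduced_svd_iff]
  have X_eq: "X = (\<Sum>k\<in>UNIV. s $ k *\<^sub>R outer_product (column k U) (column k V))"
    and Y_eq: "Y = (\<Sum>k\<in>UNIV. s' $ k *\<^sub>R outer_product (column k U') (column k V'))"
    using X Y by blast+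
  have rows: "(\<Sum>j\<in>UNIV. \<bar>B i j\<bar>) \<le> 1" for i
    unfolding B_def using X Y by (intro orthonormal_products_bound) (auto simp: orthonormal_on_def)
  have cols: "(\<Sum>i\<in>UNIV. \<bar>B i j\<bar>) \<le> 1" for j
    unfolding B_def inner_commute[of _ "column j U'"] inner_commute[of _ "column j V'"]
    using X Y by (intro orthonormal_products_bound) (auto simp: orthonormal_on_def)
  have "X \<bullet> Y = (\<Sum>i\<in>UNIV. \<Sum>j\<in>UNIV. s $ i * s' $ j * B i j)"
    unfolding B_def by (subst X_eq, subst Y_eq) (rule inner_sum_outer_products)
  also have "\<dots> \<le> (\<Sum>i\<in>UNIV. s $ i * s' $ i)"
    using assms(3,4) X Y rows cols by (intro substochastic_rearrangement) auto
  finally show ?thesis by (simp add: inner_vec_def)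
qed

lemma reduced_svd_norm:
  assumes "reduced_svd X U s V"
  shows "X \<bullet> X = s \<bullet> s"
proof -
  have "orthonormal_on UNIV (\<lambda>k. outer_product (column k U) (column k V))"
    using assms by (auto simp: reduced_svd_iff intro: orthonormal_outer_products)
  from inner_sum_orthonormal[OF this, of "($) s" "($) s"] show ?thesis
    using assms by (simp add: reduced_svd_iff inner_vec_def)
qed

text \<open>
  Ordered singular values are unique because the trace inequality, applied to two ordered
  decompositions of one matrix, gives \<open>\<langle>X, X\<rangle> \<le> \<langle>s, r\<rangle>\<close>, while \<open>\<langle>X, X\<rangle> = \<langle>s, s\<rangle> = \<langle>r, r\<rangle>\<close>; hence
  \<open>\<langle>r - s, r - s\<rangle> \<le> 0\<close>.
\<close>

lemma singular_values_eqI: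
  assumes X: "reduced_svd X U s V" and s: "antimono (($) s)"
  shows "singular_values X = s"
  unfolding singular_values_def
proof (rule the_equality)
  show "antimono (($) s) \<and> (\<exists>U V. reduced_svd X U s V)" using assms by blast
next
  fix r
  assume "antimono (($) r) \<and> (\<exists>U V. reduced_svd X U r V)"
  then obtain U' V' where r: "antimono (($) r)" "reduced_svd X U' r V'" by blast
  have "(r - s) \<bullet> (r - s) = r \<bullet> r + s \<bullet> s - 2 * (s \<bullet> r)"
    by (simp add: inner_diff_left inner_diff_right inner_commute)
  also have "\<dots> \<le> 0"
    using von_neumann_trace_inequality[OF X r(2) s r(1)] reduced_svd_norm[OF X]
      reduced_svd_norm[OF r(2)] by simp
  finally show "r = s" by (rule eq_if_inner_diff_le_zero)
qed

section \<open>Sorting a signed diagonal\<close>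

lemma exists_sorting_permutation:
  fixes x :: "'n::{finite,linorder} \<Rightarrow> real"
  shows "\<exists>\<pi> :: 'n \<Rightarrow> 'n. bij \<pi> \<and> antimono (\<lambda>i. x (\<pi> i))"
proof -
  define ls where "ls = sorted_list_of_set (UNIV :: 'n set)"
  define xs where "xs = sort_key (\<lambda>i. - x i) ls"
  have ls: "sorted ls" "distinct ls" "set ls = UNIV" unfolding ls_def by auto
  have xs: "distinct xs" "set xs = UNIV" "length xs = length ls" "sorted (map (\<lambda>i. - x i) xs)"
    using ls by (auto simp: xs_def)
  define N where "N = length ls"
  have bl: "bij_betw ((!) ls) {..<N} UNIV" using ls N_def bij_betw_nth by metis
  have bx: "bij_betw ((!) xs) {..<N} UNIV" using xs N_def bij_betw_nth by metis
  \<comment> \<open>The permutation sends the \<open>k\<close>-th smallest index to the index of the \<open>k\<close>-th largest value;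
    \<open>pos i\<close> is the rank of \<open>i\<close> among the indices.\<close>
  define pos where "pos = inv_into {..<N} ((!) ls)"
  have pos: "bij_betw pos UNIV {..<N}" unfolding pos_def by (rule bij_betw_inv_into[OF bl])
  have lspos: "ls ! pos i = i" for i
    unfolding pos_def using bl by (simp add: bij_betw_inv_into_right)
  have posN: "pos i < N" for i using pos by (auto simp: bij_betw_def)
  have mono: "pos i \<le> pos j" if "i \<le> j" for i j
  proof (rule ccontr)
    assume "\<not> pos i \<le> pos j"
    then have "pos j < pos i" by simp
    then have "ls ! pos j \<le> ls ! pos i"
      using ls(1) posN[of i] by (intro sorted_nth_mono) (auto simp: N_def)
    then have "j \<le> i" by (simp add: lspos)
    with that have "i = j" by simp
    with \<open>pos j < pos i\<close> show False by simp
  qed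
  have bij: "bij (\<lambda>i. xs ! pos i)"
    using bij_betw_trans[OF pos bx] by (simp add: comp_def)
  have anti: "antimono (\<lambda>i. x (xs ! pos i))"
  proof (rule antimonoI)
    fix i j :: 'n
    assume "i \<le> j"
    then have "map (\<lambda>i. - x i) xs ! pos i \<le> map (\<lambda>i. - x i) xs ! pos j"
      using xs(3,4) posN[of j] mono by (intro sorted_nth_mono) (auto simp: N_def)
    then show "x (xs ! pos j) \<le> x (xs ! pos i)" using xs(3) posN by (simp add: N_def)
  qed
  show ?thesis by (rule exI[where x = "\<lambda>i. xs ! pos i"], rule conjI[OF bij anti])
qed

text \<open>
  A diagonal with arbitrary entries in arbitrary order becomes an ordered decomposition:
  the signs are absorbed into the columns of \<open>U\<close> and the order into both frames.
\<close>

lemma signed_diag_sorted_svd: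
  fixes U :: "real^'n::{finite,linorder}^'m" and V :: "real^'n::{finite,linorder}^'n::{finite,linorder}"
  assumes U: "orthonormal_on UNIV (\<lambda>k. column k U)" and V: "orthonormal_on UNIV (\<lambda>k. column k V)"
    and \<pi>: "bij \<pi>" "antimono (\<lambda>i. \<bar>d $ \<pi> i\<bar>)"
  shows "\<exists>U' V'. reduced_svd (U ** diag_matrix d ** transpose V) U' (\<chi> i. \<bar>d $ \<pi> i\<bar>) V'"
proof -
  \<comment> \<open>The convention \<open>sg k = 1\<close> for a zero entry (where \<open>sgn\<close> gives 0) keeps the columns of
    \<open>U'\<close> of unit length.\<close>
  define sg where "sg k = (if d $ k < 0 then - 1 else 1 :: real)" for k
  define U' :: "real^'n::{finite,linorder}^'m" where "U' = (\<chi> a k. sg (\<pi> k) * U $ a $ \<pi> k)"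
  define V' :: "real^'n::{finite,linorder}^'n::{finite,linorder}" where "V' = (\<chi> a k. V $ a $ \<pi> k)"
  have U': "column k U' = sg (\<pi> k) *\<^sub>R column (\<pi> k) U" for k
    by (simp add: U'_def column_def vec_eq_iff)
  have V': "column k V' = column (\<pi> k) V" for k
    by (simp add: V'_def column_def vec_eq_iff)
  have inj: "\<pi> i = \<pi> j \<longleftrightarrow> i = j" for i j using \<pi>(1) by (auto simp: bij_def inj_eq)
  have "(\<Sum>k\<in>UNIV. \<bar>d $ \<pi> k\<bar> *\<^sub>R outer_product (column k U') (column k V')) =
      (\<Sum>k\<in>UNIV. d $ \<pi> k *\<^sub>R outer_product (column (\<pi> k) U) (column (\<pi> k) V))"
    by (intro sum.cong) (auto simp: U' V' outer_product_scaleR sg_def)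
  also have "\<dots> = (\<Sum>k\<in>UNIV. d $ k *\<^sub>R outer_product (column k U) (column k V))"
    by (rule sum.reindex_bij_betw[OF \<pi>(1)])
  finally have sum: "(\<Sum>k\<in>UNIV. \<bar>d $ \<pi> k\<bar> *\<^sub>R outer_product (column k U') (column k V')) =
    U ** diag_matrix d ** transpose V" by (simp add: diag_product_eq_sum_outer)
  have "orthonormal_on UNIV (\<lambda>k. column k U')"
    using U by (auto simp: orthonormal_on_def U' inj sg_def)
  moreover have "orthonormal_on UNIV (\<lambda>k. column k V')"
    using V by (auto simp: orthonormal_on_def V' inj)
  ultimately have "reduced_svd (U ** diag_matrix d ** transpose V) U' (\<chi> i. \<bar>d $ \<pi> i\<bar>) V'"
    using sum by (simp add: reduced_svd_iff)
  then show ?thesis by blast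
qed

lemma singular_values_signed_diag:
  fixes U :: "real^'n::{finite,linorder}^'m" and V :: "real^'n::{finite,linorder}^'n::{finite,linorder}"
  assumes "orthonormal_on UNIV (\<lambda>k. column k U)" "orthonormal_on UNIV (\<lambda>k. column k V)"
    and "bij \<pi>" "antimono (\<lambda>i. \<bar>d $ \<pi> i\<bar>)"
  shows "singular_values (U ** diag_matrix d ** transpose V) = (\<chi> i. \<bar>d $ \<pi> i\<bar>)"
proof -
  obtain U' V' where "reduced_svd (U ** diag_matrix d ** transpose V) U' (\<chi> i. \<bar>d $ \<pi> i\<bar>) V'"
    using signed_diag_sorted_svd[OF assms] by blast
  moreover have "antimono (($) (\<chi> i. \<bar>d $ \<pi> i\<bar>))" using assms(4) by (simp add: antimono_def)
  ultimately show ?thesis by (rule singular_values_eqI)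
qed

section \<open>Existence of singular value decompositions\<close>

lemma exists_unit_vector_orthogonal:
  fixes u :: "'i \<Rightarrow> 'a::euclidean_space"
  assumes "finite I" "card I < DIM('a)"
  shows "\<exists>a. norm a = 1 \<and> (\<forall>i\<in>I. a \<bullet> u i = 0)"
proof -
  have "dim (u ` I) \<le> card (u ` I)" using assms by (intro dim_le_card') simp
  also have "\<dots> \<le> card I" using assms by (intro card_image_le)
  finally have "dim (u ` I) < DIM('a)" using assms by simp
  then obtain x where x: "x \<noteq> 0" "\<And>y. y \<in> span (u ` I) \<Longrightarrow> orthogonal x y"
    using orthogonal_to_subspace_exists by blast
  then have "\<forall>i\<in>I. x \<bullet> u i = 0" by (simp add: orthogonal_def span_base)
  then show ?thesis using x(1) by (intro exI[of _ "x /\<^sub>R norm x"]) simp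
qed

text \<open>
  Comparing \<open>b\<close> with the unit vector in the direction of \<open>w\<close> gives \<open>\<parallel>w\<parallel> \<le> \<langle>w, b\<rangle>\<close>, so that the
  component of \<open>w\<close> orthogonal to \<open>b\<close> vanishes. This equality case of Cauchy-Schwarz replaces a Lagrange
  multiplier argument for singular vectors.
\<close>

lemma inner_maximizer_on_sphere:
  fixes w b :: "'a::real_inner"
  assumes "subspace T" "w \<in> T" "norm b = 1"
    and max: "\<And>c. c \<in> T \<Longrightarrow> norm c = 1 \<Longrightarrow> w \<bullet> c \<le> w \<bullet> b"
  shows "w = (w \<bullet> b) *\<^sub>R b"
proof (cases "w = 0")
  case False
  have ww: "w \<bullet> w = norm w * norm w"
    unfolding power2_norm_eq_inner[symmetric] by (rule power2_eq_square)
  have "w \<bullet> (w /\<^sub>R norm w) \<le> w \<bullet> b"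
    using assms False by (intro max) (auto simp: subspace_scale)
  then have le: "norm w \<le> w \<bullet> b" using False by (simp add: ww flip: mult.assoc)
  have bb: "b \<bullet> b = 1" using assms(3) by (simp add: dot_square_norm)
  have "(w - (w \<bullet> b) *\<^sub>R b) \<bullet> (w - (w \<bullet> b) *\<^sub>R b) = (norm w)\<^sup>2 - (w \<bullet> b)\<^sup>2"
    by (simp add: inner_diff_left inner_diff_right inner_commute bb ww power2_eq_square)
  also have "\<dots> \<le> 0" using le by (simp add: power_mono)
  finally show ?thesis by (rule eq_if_inner_diff_le_zero)
qed simp

text \<open>
  Greedy construction of singular vectors. If \<open>u i\<close> and \<open>v i\<close> for \<open>i \<in> I\<close> are found, then \<open>X\<close> maps the
  orthogonal complement \<open>T\<close> of the \<open>v i\<close> into the complement \<open>S\<close> of the \<open>u i\<close>, and the transpose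
  maps \<open>S\<close> into \<open>T\<close>. A maximiser \<open>(a, b)\<close> of \<open>\<langle>a, X b\<rangle>\<close> over unit vectors of \<open>S\<close> and \<open>T\<close> is a new pair,
  by the preceding lemma in each variable. Keeping both relations in the invariant, rather
  than normalising \<open>X b\<close> afterwards, also supplies the \<open>u i\<close> for zero singular values. The
  bound on the dimensions keeps \<open>S\<close> nonzero.
\<close>

lemma exists_singular_system:
  fixes X :: "real^'n^'m" and I :: "'n set"
  assumes dims: "CARD('n) \<le> CARD('m)" and "finite I"
  shows "\<exists>u v s. orthonormal_on I u \<and> orthonormal_on I v \<and>
    (\<forall>i\<in>I. 0 \<le> s i \<and> X *v v i = s i *\<^sub>R u i \<and> transpose X *v u i = s i *\<^sub>R v i)"
  using assms(2)
proof (induction I rule: finite_induct)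
  case empty
  then show ?case by (simp add: orthonormal_on_def)
next
  case (insert k I)
  then obtain u v s where u: "orthonormal_on I u" and v: "orthonormal_on I v"
    and sys: "\<And>i. i \<in> I \<Longrightarrow> 0 \<le> s i \<and> X *v v i = s i *\<^sub>R u i \<and> transpose X *v u i = s i *\<^sub>R v i"
    by blast
  have adj: "(transpose X *v a) \<bullet> b = a \<bullet> (X *v b)" for a b
    by (simp add: dot_lmul_matrix)
  define S where "S = {a. \<forall>i\<in>I. a \<bullet> u i = 0}"
  define T where "T = {b. \<forall>i\<in>I. b \<bullet> v i = 0}"
  have subS: "subspace S" unfolding S_def by (auto simp: subspace_def inner_add_left)
  have subT: "subspace T" unfolding T_def by (auto simp: subspace_def inner_add_left)
  have "card I < card (UNIV :: 'n set)" using insert.hyps by (intro psubset_card_mono) auto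
  then have "card I < DIM(real^'n)" "card I < DIM(real^'m)" using dims by auto
  then obtain a0 b0 where ab0: "norm a0 = 1" "a0 \<in> S" "norm b0 = 1" "b0 \<in> T"
    unfolding S_def T_def
    using exists_unit_vector_orthogonal[OF insert.hyps(1), of u]
      exists_unit_vector_orthogonal[OF insert.hyps(1), of v] by blast
  define C where "C = (sphere 0 1 \<inter> S) \<times> (sphere 0 1 \<inter> T)"
  have "compact C" unfolding C_def
    by (intro compact_Times compact_Int_closed closed_subspace subS subT compact_sphere)
  moreover have "C \<noteq> {}" using ab0 by (auto simp: C_def)
  moreover have "continuous_on C (\<lambda>w. fst w \<bullet> (X *v snd w))"
    by (intro continuous_intros bounded_linear.continuous_on[OF matrix_vector_mul_bounded_linear])
  ultimately obtain w where w: "w \<in> C"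
    and wmax: "\<And>w'. w' \<in> C \<Longrightarrow> fst w' \<bullet> (X *v snd w') \<le> fst w \<bullet> (X *v snd w)"
    using continuous_attains_sup[of C] by blast
  define a b where "a = fst w" and "b = snd w"
  define m where "m = a \<bullet> (X *v b)"
  have ab: "norm a = 1" "a \<in> S" "norm b = 1" "b \<in> T"
    using w by (auto simp: C_def a_def b_def)
  have max: "a' \<bullet> (X *v b') \<le> m" if "norm a' = 1" "a' \<in> S" "norm b' = 1" "b' \<in> T" for a' b'
    using wmax[of "(a', b')"] that by (simp add: C_def m_def a_def b_def)
  have "0 \<le> m"
    \<comment> \<open>The maximum is nonnegative since \<open>(- a, b)\<close> competes with \<open>(a, b)\<close>.\<close>
    using max[of "- a" b] ab subspace_neg[OF subS] by (simp add: m_def)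
  have XbS: "X *v b \<in> S"
  proof -
    have "(X *v b) \<bullet> u i = 0" if "i \<in> I" for i
      unfolding inner_commute[of "X *v b"] adj[symmetric]
      using sys[OF that] ab(4) that by (simp add: T_def inner_commute)
    then show ?thesis by (simp add: S_def)
  qed
  have XaT: "transpose X *v a \<in> T"
  proof -
    have "(transpose X *v a) \<bullet> v i = 0" if "i \<in> I" for i
      unfolding adj using sys[OF that] ab(2) that by (simp add: S_def)
    then show ?thesis unfolding T_def by blast
  qed
  have "X *v b = ((X *v b) \<bullet> a) *\<^sub>R a"
    using max ab by (intro inner_maximizer_on_sphere[OF subS XbS])
      (simp_all add: m_def inner_commute)
  then have Xb: "X *v b = m *\<^sub>R a" by (simp add: m_def inner_commute)
  have "transpose X *v a = ((transpose X *v a) \<bullet> b) *\<^sub>R b"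
    using max ab by (intro inner_maximizer_on_sphere[OF subT XaT]) 
      (simp_all add: m_def adj del: transpose_matrix_vector)
  then have Xa: "transpose X *v a = m *\<^sub>R b" unfolding adj m_def .
  have unit: "a \<bullet> a = 1" "b \<bullet> b = 1" using ab by (simp_all add: dot_square_norm)
  have "orthonormal_on (insert k I) (u(k := a))"
    using u ab unit insert.hyps by (auto simp: orthonormal_on_def S_def inner_commute)
  moreover have "orthonormal_on (insert k I) (v(k := b))"
    using v ab unit insert.hyps by (auto simp: orthonormal_on_def T_def inner_commute)
  moreover have "\<forall>i\<in>insert k I. 0 \<le> (s(k := m)) i \<and> X *v (v(k := b)) i = (s(k := m)) i *\<^sub>R (u(k := a)) i \<and>
      transpose X *v (u(k := a)) i = (s(k := m)) i *\<^sub>R (v(k := b)) i"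
    using sys Xa Xb \<open>0 \<le> m\<close> insert.hyps by auto
  ultimately show ?case by blast
qed

lemma exists_reduced_svd:
  fixes X :: "real^'n^'m"
  assumes "CARD('n) \<le> CARD('m)"
  shows "\<exists>U s V. reduced_svd X U s V"
proof -
  obtain u v s where u: "orthonormal_on (UNIV :: 'n set) u" and v: "orthonormal_on (UNIV :: 'n set) v"
    and sys: "\<And>i. 0 \<le> s i" "\<And>i. X *v v i = s i *\<^sub>R u i"
    using exists_singular_system[OF assms finite_class.finite_UNIV, of X] by auto
  define U :: "real^'n^'m" where "U = (\<chi> a k. u k $ a)"
  define V :: "real^'n^'n" where "V = (\<chi> a k. v k $ a)"
  have cols: "(\<lambda>k. column k U) = u" "(\<lambda>k. column k V) = v"
    by (simp_all add: U_def V_def column_def vec_eq_iff fun_eq_iff)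
  have VV: "transpose V ** V = mat 1" using v by (simp add: orthonormal_columns_iff cols)
  have "(X ** V) $ a $ k = (U ** diag_matrix (\<chi> i. s i)) $ a $ k" for a k
  proof -
    have "(X ** V) $ a $ k = (X *v v k) $ a"
      by (simp add: matrix_matrix_mult_def matrix_vector_mult_def V_def)
    also have "\<dots> = (U ** diag_matrix (\<chi> i. s i)) $ a $ k"
      by (simp add: sys matrix_matrix_mult_def diag_matrix_def U_def if_distrib cong: if_cong)
    finally show ?thesis .
  qed
  then have XV: "X ** V = U ** diag_matrix (\<chi> i. s i)" by (simp add: vec_eq_iff)
  have "X = X ** (V ** transpose V)"
    using VV matrix_left_right_inverse[of V "transpose V"] by simp
  also have "\<dots> = U ** diag_matrix (\<chi> i. s i) ** transpose V"
    by (simp add: matrix_mul_assoc XV)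
  finally have "reduced_svd X U (\<chi> i. s i) V"
    using u VV sys by (simp add: reduced_svd_def orthonormal_columns_iff cols)
  then show ?thesis by blast
qed

lemma exists_sorted_svd:
  fixes X :: "real^'n::{finite,linorder}^'m"
  assumes "CARD('n) \<le> CARD('m)"
  shows "\<exists>U V. reduced_svd X U (singular_values X) V \<and> antimono (($) (singular_values X))"
proof -
  obtain U s V where X: "reduced_svd X U s V" using exists_reduced_svd[OF assms] by blast
  obtain \<pi> :: "'n \<Rightarrow> 'n" where \<pi>: "bij \<pi>" "antimono (\<lambda>i. \<bar>s $ \<pi> i\<bar>)"
    using exists_sorting_permutation[of "\<lambda>i. \<bar>s $ i\<bar>"] by blast
  obtain U' V' where "reduced_svd X U' (\<chi> i. \<bar>s $ \<pi> i\<bar>) V'"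
    using signed_diag_sorted_svd[OF _ _ \<pi>, of U V] X
    by (auto simp: reduced_svd_iff diag_product_eq_sum_outer)
  moreover have "antimono (($) (\<chi> i. \<bar>s $ \<pi> i\<bar>))" using \<pi> by (simp add: antimono_def)
  ultimately show ?thesis using singular_values_eqI by metis
qed

section \<open>Signed permutations\<close>

text \<open>
  Both \<open>f x\<close> and \<open>f y\<close> reduce to \<open>f\<close> at the common vector of permuted absolute values: \<open>y\<close> by the
  identity permutation, \<open>x\<close> by \<open>\<pi>\<close>.
\<close>

lemma absolutely_symmetric_signed_permutation:
  assumes f: "absolutely_symmetric f" and "bij \<pi>" "\<And>i. \<bar>y $ i\<bar> = \<bar>x $ \<pi> i\<bar>"
  shows "f y = f x"
proof -
  have eq: "f x = f (\<chi> i. \<bar>x $ \<pi> i\<bar>)" if "bij \<pi>" for \<pi> and x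
  proof -
    let ?P = "\<chi> i j. if j = \<pi> i then 1 else 0"
    have "permutation_matrix ?P" using that by (auto simp: permutation_matrix_def)
    then have "f x = f \<bar>?P *v x\<bar>" using f unfolding absolutely_symmetric_def by blast
    also have "\<bar>?P *v x\<bar> = (\<chi> i. \<bar>x $ \<pi> i\<bar>)"
      by (simp add: vec_eq_iff abs_vec_def matrix_vector_mult_def if_distrib[of "\<lambda>c. c * _"] cong: if_cong)
    finally show ?thesis .
  qed
  have "f y = f (\<chi> i. \<bar>y $ i\<bar>)" using eq[OF bij_id, of y] by simp
  also have "\<dots> = f x" using eq[OF assms(2), of x] assms(3) by simp
  finally show ?thesis .
qed

lemma absolutely_symmetric_singular_values_diag:
  fixes U :: "real^'n::{finite,linorder}^'m" and V :: "real^'n::{finite,linorder}^'n::{finite,linorder}"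
  assumes f: "absolutely_symmetric f"
    and U: "orthonormal_on UNIV (\<lambda>k. column k U)" and V: "orthonormal_on UNIV (\<lambda>k. column k V)"
  shows "f (singular_values (U ** diag_matrix x ** transpose V)) = f x"
proof -
  obtain \<pi> :: "'n \<Rightarrow> 'n" where \<pi>: "bij \<pi>" "antimono (\<lambda>i. \<bar>x $ \<pi> i\<bar>)"
    using exists_sorting_permutation[of "\<lambda>i. \<bar>x $ i\<bar>"] by blast
  show ?thesis
    unfolding singular_values_signed_diag[OF U V \<pi>]
    by (rule absolutely_symmetric_signed_permutation[OF f \<pi>(1)]) simp
qed

text \<open>
  The form of the trace inequality for a diagonal \<open>d\<close> with signs and no particular order:
  undoing the sorting of \<open>\<bar>d\<bar>\<close> on the other side turns \<open>\<langle>sort \<bar>d\<bar>, \<sigma>(Y)\<rangle>\<close> into \<open>\<langle>d, x\<rangle>\<close>, where \<open>x\<close>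
  arranges the singular values of \<open>Y\<close> in the order of \<open>\<bar>d\<bar>\<close> and with the signs of \<open>d\<close>.
\<close>

lemma inner_diag_le_signed_permutation:
  fixes U Y :: "real^'n::{finite,linorder}^'m" and V :: "real^'n::{finite,linorder}^'n::{finite,linorder}"
  assumes U: "orthonormal_on UNIV (\<lambda>k. column k U)" and V: "orthonormal_on UNIV (\<lambda>k. column k V)"
    and dims: "CARD('n) \<le> CARD('m)"
  shows "\<exists>\<rho> x. bij \<rho> \<and> (\<forall>i. \<bar>x $ i\<bar> = \<bar>singular_values Y $ \<rho> i\<bar>) \<and>
    (U ** diag_matrix d ** transpose V) \<bullet> Y \<le> d \<bullet> x"
proof -
  let ?r = "singular_values Y"
  obtain \<pi> :: "'n \<Rightarrow> 'n" where \<pi>: "bij \<pi>" "antimono (\<lambda>i. \<bar>d $ \<pi> i\<bar>)"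
    using exists_sorting_permutation[of "\<lambda>i. \<bar>d $ i\<bar>"] by blast
  obtain U1 V1 where D: "reduced_svd (U ** diag_matrix d ** transpose V) U1 (\<chi> i. \<bar>d $ \<pi> i\<bar>) V1"
    using signed_diag_sorted_svd[OF U V \<pi>] by blast
  obtain U2 V2 where Y: "reduced_svd Y U2 ?r V2" "antimono (($) ?r)"
    using exists_sorted_svd[OF dims] by blast
  have inv: "bij (inv \<pi>)" "\<And>i. inv \<pi> (\<pi> i) = i"
    using \<pi>(1) by (auto simp: bij_imp_bij_inv bij_is_inj)
  define x where "x = (\<chi> i. (if d $ i < 0 then - 1 else 1) * ?r $ inv \<pi> i)"
  have "(U ** diag_matrix d ** transpose V) \<bullet> Y \<le> (\<chi> i. \<bar>d $ \<pi> i\<bar>) \<bullet> ?r"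
    using \<pi>(2) by (intro von_neumann_trace_inequality[OF D Y(1)] Y(2)) (simp add: antimono_def)
  also have "\<dots> = (\<Sum>i\<in>UNIV. \<bar>d $ \<pi> i\<bar> * ?r $ inv \<pi> (\<pi> i))"
    by (simp add: inner_vec_def inv)
  also have "\<dots> = (\<Sum>i\<in>UNIV. \<bar>d $ i\<bar> * ?r $ inv \<pi> i)"
    by (rule sum.reindex_bij_betw[OF \<pi>(1)])
  also have "\<dots> = d \<bullet> x"
    by (auto simp: inner_vec_def x_def intro: sum.cong)
  finally show ?thesis
    using inv(1) by (intro exI[of _ "inv \<pi>"] exI[of _ x]) (simp add: x_def abs_mult)
qed

section \<open>Spectral cones and their projections\<close>

lemma perspective_le_iff:
  assumes "0 < v"
  shows "ereal v * e \<le> ereal t \<longleftrightarrow> e \<le> ereal (t / v)"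
  using assms by (cases e) (auto simp: field_simps)

text \<open>
  The perspective \<open>v f(x / v)\<close> of a convex function is convex: \<open>x / v\<close> for a combination of two
  triples is the combination of the quotients with weights \<open>\<alpha>\<close> and \<open>\<beta>\<close> proportional to
  \<open>u v1\<close> and \<open>w v2\<close>.
\<close>

lemma convex_spectral_cone:
  assumes f: "convex_ereal f"
  shows "convex (spectral_cone f)"
proof -
  let ?G = "{(t, v, x). 0 < v \<and> ereal v * f (x /\<^sub>R v) \<le> ereal t}"
  have "u *\<^sub>R p + w *\<^sub>R q \<in> ?G"
    if pq: "p \<in> ?G" "q \<in> ?G" and uw: "0 < u" "0 < w" for p q u w
  proof -
    obtain t1 v1 x1 where p: "p = (t1, v1, x1)" by (cases p)
    obtain t2 v2 x2 where q: "q = (t2, v2, x2)" by (cases q)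
    have v: "0 < v1" "0 < v2" using pq by (auto simp: p q)
    have le: "f (x1 /\<^sub>R v1) \<le> ereal (t1 / v1)" "f (x2 /\<^sub>R v2) \<le> ereal (t2 / v2)"
      using pq v by (auto simp: p q perspective_le_iff)
    define v where "v = u * v1 + w * v2"
    have v0: "0 < v" using uw v by (simp add: v_def add_pos_pos)
    define \<alpha> \<beta> where "\<alpha> = u * v1 / v" and "\<beta> = w * v2 / v"
    have ab: "0 < \<alpha>" "0 < \<beta>" "\<alpha> + \<beta> = 1"
      using uw v v0 by (auto simp: \<alpha>_def \<beta>_def v_def simp flip: add_divide_distrib)
    have "(u *\<^sub>R x1 + w *\<^sub>R x2) /\<^sub>R v = \<alpha> *\<^sub>R (x1 /\<^sub>R v1) + \<beta> *\<^sub>R (x2 /\<^sub>R v2)"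
    proof -
      have "\<alpha> * inverse v1 = inverse v * u" "\<beta> * inverse v2 = inverse v * w"
        using v by (auto simp: \<alpha>_def \<beta>_def field_simps)
      then show ?thesis by (simp add: scaleR_add_right)
    qed
    then have "f ((u *\<^sub>R x1 + w *\<^sub>R x2) /\<^sub>R v)
        \<le> ereal \<alpha> * f (x1 /\<^sub>R v1) + ereal \<beta> * f (x2 /\<^sub>R v2)"
      using f ab unfolding convex_ereal_def by metis
    also have "\<dots> \<le> ereal \<alpha> * ereal (t1 / v1) + ereal \<beta> * ereal (t2 / v2)"
      using ab le by (intro add_mono ereal_mult_left_mono) auto
    also have "\<dots> = ereal ((u * t1 + w * t2) / v)"
      using v v0 by (simp add: \<alpha>_def \<beta>_def add_divide_distrib)
    finally show ?thesis
      using v0 by (simp add: p q perspective_le_iff flip: v_def)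
  qed
  then have "u *\<^sub>R p + w *\<^sub>R q \<in> ?G"
    if "p \<in> ?G" "q \<in> ?G" "0 \<le> u" "0 \<le> w" "u + w = 1" for p q u w
    using that by (cases "u = 0"; cases "w = 0") (simp_all del: mem_Collect_eq)
  then have "convex ?G" by (rule convexI)
  then show ?thesis unfolding spectral_cone_def by (rule convex_closure)
qed

lemma spectral_cone_nonempty:
  assumes "\<bar>f x\<bar> \<noteq> \<infinity>"
  shows "spectral_cone f \<noteq> {}"
proof -
  have "(real_of_ereal (f x), 1, x) \<in> {(t, v, x). 0 < v \<and> ereal v * f (x /\<^sub>R v) \<le> ereal t}"
    using assms by (simp add: ereal_real flip: one_ereal_def)
  then show ?thesis unfolding spectral_cone_def using closure_subset by blast
qed

text \<open>
  The variational inequality at \<open>q\<close> gives \<open>\<parallel>z - w\<parallel>\<^sup>2 \<ge> \<parallel>z - q\<parallel>\<^sup>2 + \<parallel>w - q\<parallel>\<^sup>2\<close> on \<open>S\<close>, so \<open>q\<close> is the only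
  minimiser.
\<close>

lemma closest_point_eqI:
  assumes "closed S" "q \<in> S" and obtuse: "\<And>w. w \<in> S \<Longrightarrow> (z - q) \<bullet> (w - q) \<le> 0"
  shows "closest_point S z = q"
proof -
  let ?c = "closest_point S z"
  have "?c \<in> S" "dist z ?c \<le> dist z q"
    using assms closest_point_exists[of S z] by auto
  have "(norm (z - ?c))\<^sup>2 = (norm (z - q))\<^sup>2 + (norm (?c - q))\<^sup>2 - 2 * ((z - q) \<bullet> (?c - q))"
    by (simp add: inner_diff_left inner_diff_right inner_commute algebra_simps flip: dot_square_norm)
  moreover have "(norm (z - ?c))\<^sup>2 \<le> (norm (z - q))\<^sup>2"
    using \<open>dist z ?c \<le> dist z q\<close> by (simp add: dist_norm power_mono)
  ultimately have "(norm (?c - q))\<^sup>2 \<le> 0" using obtuse[OF \<open>?c \<in> S\<close>] by linarith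
  then show ?thesis by simp
qed

theorem theorem2:
  fixes f :: "real^'n::{finite,linorder} \<Rightarrow> ereal"
    and F :: "real^'n::{finite,linorder}^'m \<Rightarrow> ereal"
    and t v :: real
    and X U :: "real^'n::{finite,linorder}^'m" and V :: "real^'n::{finite,linorder}^'n::{finite,linorder}" and s :: "real^'n::{finite,linorder}"
  assumes "CARD('n) \<le> CARD('m)"
    and "\<forall>x. f x \<noteq> -\<infinity>"
    and "\<exists>x. f x \<noteq> \<infinity>"
    and "absolutely_symmetric f"
    and "convex_ereal f"
    and "\<forall>Y. F Y = f (singular_values Y)"
    and "reduced_svd X U s V"
  shows "fst (closest_point (spectral_cone F) (t, v, X)) =
           fst (closest_point (spectral_cone f) (t, v, s)) \<and>
         fst (snd (closest_point (spectral_cone F) (t, v, X))) =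
           fst (snd (closest_point (spectral_cone f) (t, v, s))) \<and>
         snd (snd (closest_point (spectral_cone F) (t, v, X))) =
           U ** diag_matrix (snd (snd (closest_point (spectral_cone f) (t, v, s)))) ** transpose V"
proof -
  note dims = assms(1) and sym = assms(4) and F = assms(6)
  have U: "orthonormal_on UNIV (\<lambda>k. column k U)" and V: "orthonormal_on UNIV (\<lambda>k. column k V)"
    and X: "X = U ** diag_matrix s ** transpose V"
    using assms(7) by (auto simp: reduced_svd_def orthonormal_columns_iff)
  define D where "D d = U ** diag_matrix d ** transpose V" for d
  have D_sum: "D d = (\<Sum>k\<in>UNIV. d $ k *\<^sub>R outer_product (column k U) (column k V))" for d
    by (simp add: D_def diag_product_eq_sum_outer)
  have D_diff: "D (d - e) = D d - D e" for d e
    by (simp add: D_sum scaleR_diff_left sum_subtractf)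
  have D_scale: "D (c *\<^sub>R d) = c *\<^sub>R D d" for c d
    by (simp add: D_sum scaleR_sum_right)
  have D_inner: "D d \<bullet> D e = d \<bullet> e" for d e
    unfolding D_sum inner_sum_orthonormal[OF orthonormal_outer_products[OF U V] finite_class.finite_UNIV]
    by (simp add: inner_vec_def)
  define Gf where "Gf = {(t, v, x). 0 < v \<and> ereal v * f (x /\<^sub>R v) \<le> ereal t}"
  define GF where "GF = {(t, v, Y). 0 < v \<and> ereal v * F (Y /\<^sub>R v) \<le> ereal t}"
  let ?K = "spectral_cone f" and ?KF = "spectral_cone F"
  have K: "?K = closure Gf" "?KF = closure GF" by (simp_all add: spectral_cone_def Gf_def GF_def)
  have "convex ?K" "closed ?K" using convex_spectral_cone[OF assms(5)] by (simp_all add: K)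
  obtain x0 where "f x0 \<noteq> \<infinity>" using assms(3) by blast
  then have "?K \<noteq> {}" using assms(2) by (intro spectral_cone_nonempty[of f x0]) auto
  obtain a b y where p: "closest_point ?K (t, v, s) = (a, b, y)" by (cases "closest_point ?K (t, v, s)")
  have pK: "(a, b, y) \<in> ?K"
    using closest_point_in_set[of ?K "(t, v, s)"] \<open>?K \<noteq> {}\<close> \<open>closed ?K\<close> by (simp add: p)
  have dot: "((t, v, s) - (a, b, y)) \<bullet> (w - (a, b, y)) \<le> 0" if "w \<in> ?K" for w
    using closest_point_dot[of ?K w "(t, v, s)"] \<open>convex ?K\<close> \<open>closed ?K\<close> that by (simp only: p)
  \<comment> \<open>\<open>L\<close> lifts the vector cone into the matrix cone: it does so on generators, and it is
    continuous.\<close>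
  define L where "L w = (fst w, fst (snd w), D (snd (snd w)))" for w :: "real \<times> real \<times> _"
  have L_mem: "L w \<in> GF" if "w \<in> Gf" for w
  proof -
    have "F (D x) = f x" for x
      unfolding D_def using F absolutely_symmetric_singular_values_diag[OF sym U V] by simp
    then show ?thesis using that by (auto simp: L_def Gf_def GF_def simp flip: D_scale)
  qed
  have "continuous_on (closure Gf) L"
    unfolding L_def D_sum by (intro continuous_intros)
  then have "L ` closure Gf \<subseteq> closure GF"
    using L_mem closure_subset by (intro image_closure_subset) blast+
  then have qK: "(a, b, D y) \<in> ?KF" using pK by (force simp: K L_def)
  have "((t, v, X) - (a, b, D y)) \<bullet> (w - (a, b, D y)) \<le> 0" if "w \<in> GF" for w
  proof -
    obtain t' v' Y where w: "w = (t', v', Y)" by (cases w)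
    have v': "0 < v'" using that by (simp add: w GF_def)
    \<comment> \<open>The signed permutation is taken of the singular values of \<open>Y / v'\<close>, where \<open>F\<close> is
      evaluated; scaling by \<open>v'\<close> then avoids homogeneity of the singular values.\<close>
    obtain \<rho> x where x: "bij \<rho>" "\<And>i. \<bar>x $ i\<bar> = \<bar>singular_values (Y /\<^sub>R v') $ \<rho> i\<bar>"
      and le: "D (s - y) \<bullet> (Y /\<^sub>R v') \<le> (s - y) \<bullet> x"
      using inner_diag_le_signed_permutation[OF U V dims, of "Y /\<^sub>R v'" "s - y"]
      unfolding D_def by blast
    have "f x = F (Y /\<^sub>R v')"
      using absolutely_symmetric_signed_permutation[OF sym x] F by simp
    then have "(t', v', v' *\<^sub>R x) \<in> Gf"
      using that v' by (simp add: w Gf_def GF_def)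
    then have "(t', v', v' *\<^sub>R x) \<in> ?K" using closure_subset K by blast
    from dot[OF this] have "(t - a) * (t' - a) + (v - b) * (v' - b) + (s - y) \<bullet> (v' *\<^sub>R x - y) \<le> 0"
      by (simp add: add.assoc)
    moreover have "D (s - y) \<bullet> (Y - D y) \<le> (s - y) \<bullet> (v' *\<^sub>R x - y)"
      using le v' by (simp add: inner_diff_right D_inner field_simps)
    ultimately show ?thesis by (simp add: w X D_diff flip: D_def)
  qed
  then have "GF \<subseteq> {w. ((t, v, X) - (a, b, D y)) \<bullet> (w - (a, b, D y)) \<le> 0}" by blast
  moreover have "closed {w. ((t, v, X) - (a, b, D y)) \<bullet> (w - (a, b, D y)) \<le> 0}"
    by (intro closed_Collect_le continuous_intros)
  ultimately have "?KF \<subseteq> {w. ((t, v, X) - (a, b, D y)) \<bullet> (w - (a, b, D y)) \<le> 0}"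
    unfolding K by (rule closure_minimal)
  then have "closest_point ?KF (t, v, X) = (a, b, D y)"
    using qK by (intro closest_point_eqI) (auto simp: K)
  then show ?thesis by (simp add: p D_def)
qed
end
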